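(* Let $a\ge 1$ be an integer and $0<b\le 1$. Then the function $$g_{a,b}(y)=\frac{\Gamma(y+a)\,\Gamma(y+b)}{\Gamma(y)\,\Gamma(y+a+b)},\qquad y>0,$$ is a complete Bernstein function.
   Context: A function $f:(0,\infty)\to[0,\infty)$ is completely monotone if $f\in C^\infty$ and $(-1)^n f^{(n)}(x)\ge 0$ for all $n\ge 0$, $x>0$. A function $g:(0,\infty)\to[0,\infty)$ is a Bernstein function if $g\in C^\infty$ and $g'$ is completely monotone; equivalently, with unique $(a_0,b_0,\nu)$, $g(x)=a_0+b_0x+\int_{(0,\infty)}(1-e^{-xt})\,\nu(dt)$, where $a_0,b_0\ge 0$ and $\nu$ is a positive measure on $(0,\infty)$ (the Lévy measure) with $\int(1\wedge t)\,\nu(dt)<\infty$. A Bernstein function is a complete Bernstein function if its Lévy measure is absolutely continuous with a completely monotone density. *)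

theory Defs
  imports "HOL-Analysis.Analysis"
begin

text \<open>
  Functions on the open half-line are total functions of type real to real of which only the values
  on the positive reals matter; since the half-line is open, iterated derivatives at its points do
  not depend on the values elsewhere.
\<close>

definition smooth_on_pos :: "(real \<Rightarrow> real) \<Rightarrow> bool" where
  "smooth_on_pos f \<longleftrightarrow> (\<forall>n. \<forall>x>0. (deriv ^^ n) f differentiable (at x))"

text \<open>The case \<open>n = 0\<close> says that \<open>f\<close> is nonnegative.\<close>

definition completely_monotone :: "(real \<Rightarrow> real) \<Rightarrow> bool" where
  "completely_monotone f \<longleftrightarrow>
     smooth_on_pos f \<and> (\<forall>n. \<forall>x>0. (-1) ^ n * (deriv ^^ n) f x \<ge> 0)"

definition bernstein_function :: "(real \<Rightarrow> real) \<Rightarrow> bool" where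
  "bernstein_function g \<longleftrightarrow>
     (\<forall>x>0. g x \<ge> 0) \<and> smooth_on_pos g \<and> completely_monotone (deriv g)"

text \<open>
  \<open>(a\<^sub>0, b\<^sub>0, \<nu>)\<close> is the Levy triple of \<open>g\<close>, with \<open>\<nu>\<close> a Borel measure on the open half-line.
  The condition on \<open>min 1 t\<close> makes the integrand of the last line \<open>\<nu>\<close>-integrable for each \<open>x > 0\<close>,
  so the Bochner integral is the genuine one.
\<close>

definition levy_triple :: "(real \<Rightarrow> real) \<Rightarrow> real \<Rightarrow> real \<Rightarrow> real measure \<Rightarrow> bool" where
  "levy_triple g a\<^sub>0 b\<^sub>0 \<nu> \<longleftrightarrow>
     a\<^sub>0 \<ge> 0 \<and> b\<^sub>0 \<ge> 0 \<and>
     sets \<nu> = sets (restrict_space borel {0<..}) \<and>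
     (\<integral>\<^sup>+ t. ennreal (min 1 t) \<partial>\<nu>) < \<infinity> \<and>
     (\<forall>x>0. g x = a\<^sub>0 + b\<^sub>0 * x + (\<integral>t. (1 - exp (- x * t)) \<partial>\<nu>))"

text \<open>
  The Levy triple of a Bernstein function exists and is unique, so the existential over the triple
  below speaks about the Levy measure of \<open>g\<close>.
\<close>

definition complete_bernstein_function :: "(real \<Rightarrow> real) \<Rightarrow> bool" where
  "complete_bernstein_function g \<longleftrightarrow>
     bernstein_function g \<and>
     (\<exists>a\<^sub>0 b\<^sub>0 \<nu>. levy_triple g a\<^sub>0 b\<^sub>0 \<nu> \<and>
        (\<exists>m. completely_monotone m \<and>
             \<nu> = density (restrict_space lborel {0<..}) (\<lambda>t. ennreal (m t))))"

end

theory Submission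
  imports Defs "HOL-Real_Asymp.Real_Asymp"
begin

text \<open>
  Cancelling the Gamma factors shows that \<open>g\<^bsub>a,b\<^esub>\<close> is the rational function
  \<open>\<Prod>j<a. (y + j) / (y + b + j)\<close>. Its zeros \<open>- j\<close> and poles \<open>- (b + j)\<close> alternate because
  \<open>0 < b \<le> 1\<close> (for \<open>b = 1\<close> neighbouring ones cancel), and alternation forces every residue to be
  nonpositive
  (\<open>interlacing_partial_fractions\<close>). Since the value at infinity is 1 and the value at \<open>0\<close> is 0,
  this gives \<open>g\<^bsub>a,b\<^esub>(y) = \<Sum>k<a. p\<^sub>k (1 / s\<^sub>k - 1 / (y + s\<^sub>k))\<close> with \<open>p\<^sub>k \<ge> 0\<close> and \<open>s\<^sub>k = b + k\<close>.

  Each summand is the elementary complete Bernstein function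
  \<open>1 / s - 1 / (y + s) = \<integral> (1 - exp (- y t)) exp (- s t) dt\<close>, so the Levy measure of the sum has the
  completely monotone density \<open>\<Sum>k<a. p\<^sub>k exp (- s\<^sub>k t)\<close>, without drift or constant term
  (\<open>complete_bernstein_function_finite_Stieltjes\<close>).
\<close>

section \<open>Iterated derivatives on the half-line\<close>

text \<open>
  Exhibiting a whole chain of candidate derivatives determines the iterated derivatives on the
  half-line even when the first function of the chain agrees with \<open>f\<close> only there.
\<close>

lemma derivative_chain:
  fixes f :: "real \<Rightarrow> real" and F :: "nat \<Rightarrow> real \<Rightarrow> real"
  assumes f: "\<And>x. x > 0 \<Longrightarrow> f x = F 0 x"
    and F: "\<And>n x. x > 0 \<Longrightarrow> (F n has_real_derivative F (Suc n) x) (at x)"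
  shows deriv_funpow_chain: "x > 0 \<Longrightarrow> (deriv ^^ n) f x = F n x"
    and smooth_on_pos_chain: "smooth_on_pos f"
proof -
  have step: "(h has_real_derivative F (Suc n) x) (at x)"
    if "\<And>x. x > 0 \<Longrightarrow> h x = F n x" "x > 0" for h n x
    using has_field_derivative_transform_within_open[OF F[of x n], of "{0<..}" h] that by auto
  have eq: "(deriv ^^ n) f x = F n x" if "x > 0" for n x
    using that
  proof (induction n arbitrary: x)
    case 0
    then show ?case by (simp add: f)
  next
    case (Suc n)
    show ?case using DERIV_imp_deriv[OF step[OF Suc.IH Suc.prems]] by simp
  qed
  show "x > 0 \<Longrightarrow> (deriv ^^ n) f x = F n x" by (rule eq)
  show "smooth_on_pos f"
    unfolding smooth_on_pos_def
    using step[OF eq] by (metis real_differentiable_def)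
qed

lemma completely_monotone_chain:
  fixes f :: "real \<Rightarrow> real" and F :: "nat \<Rightarrow> real \<Rightarrow> real"
  assumes "\<And>x. x > 0 \<Longrightarrow> f x = F 0 x"
    and "\<And>n x. x > 0 \<Longrightarrow> (F n has_real_derivative F (Suc n) x) (at x)"
    and "\<And>n x. x > 0 \<Longrightarrow> (-1) ^ n * F n x \<ge> 0"
  shows "completely_monotone f"
  unfolding completely_monotone_def
  using smooth_on_pos_chain[of f F] deriv_funpow_chain[of f F] assms by simp

section \<open>Finite sums of elementary complete Bernstein functions\<close>

lemma has_bochner_integral_exp_pos:
  fixes s :: real
  assumes "s > 0"
  shows "has_bochner_integral (restrict_space lborel {0<..}) (\<lambda>t. exp (- s * t)) (1 / s)"
proof -
  have "(\<integral>\<^sup>+ t. ennreal (exp (- s * t)) * indicator {0..} t \<partial>lborel) = ennreal (0 - (- exp (- s * 0) / s))"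
  proof (rule nn_integral_FTC_atLeast)
    show "((\<lambda>t. - exp (- s * t) / s) \<longlongrightarrow> 0) at_top"
      using assms by real_asymp
  qed (use assms in \<open>auto intro!: derivative_eq_intros\<close>)
  moreover have "AE t in lborel. ennreal (exp (- s * t)) * indicator {0..} t
      = ennreal (exp (- s * t)) * indicator {0<..} t"
    using AE_lborel_singleton[of "0::real"] by eventually_elim (auto split: split_indicator)
  ultimately have "(\<integral>\<^sup>+ t. ennreal (exp (- s * t)) * indicator {0<..} t \<partial>lborel) = ennreal (1 / s)"
    using nn_integral_cong_AE by fastforce
  then have "(\<integral>\<^sup>+ t. ennreal (exp (- s * t)) \<partial>restrict_space lborel {0<..}) = ennreal (1 / s)"
    by (simp add: nn_integral_restrict_space)
  then show ?thesis
    using assms by (intro has_bochner_integral_nn_integral) (auto intro: measurable_restrict_space1)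
qed

text \<open>
  By \<open>\<integral> exp (- c t) dt = 1 / c\<close> at \<open>c = s\<^sub>k\<close> and at \<open>c = x + s\<^sub>k\<close>, each term is
  \<open>p\<^sub>k \<integral> (1 - exp (- x t)) exp (- s\<^sub>k t) dt\<close>, so the Levy measure is a finite mixture of exponential
  densities. As their total mass is finite, the integrability condition on the Levy measure is
  immediate from \<open>min 1 t \<le> 1\<close>.
\<close>

lemma complete_bernstein_function_finite_Stieltjes:
  fixes g :: "real \<Rightarrow> real" and p s :: "'k \<Rightarrow> real"
  assumes p: "\<And>k. k \<in> K \<Longrightarrow> p k \<ge> 0" and s: "\<And>k. k \<in> K \<Longrightarrow> s k > 0"
    and g: "\<And>x. x > 0 \<Longrightarrow> g x = (\<Sum>k\<in>K. p k * (1 / s k - 1 / (x + s k)))"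
  shows "complete_bernstein_function g"
proof -
  let ?L = "restrict_space lborel {0::real<..}"
  define m where "m = (\<lambda>t. \<Sum>k\<in>K. p k * exp (- s k * t))"
  define \<nu> where "\<nu> = density ?L (\<lambda>t. ennreal (m t))"
  define F where "F n x = (case n of 0 \<Rightarrow> \<Sum>k\<in>K. p k * (1 / s k - 1 / (x + s k))
    | Suc i \<Rightarrow> \<Sum>k\<in>K. p k * ((-1) ^ i * fact n / (x + s k) ^ Suc n))" for n x
  have pos: "x + s k > 0" if "k \<in> K" "x > 0" for k x
    using s[OF that(1)] that(2) by simp
  have F: "(F n has_real_derivative F (Suc n) x) (at x)" if x: "x > 0" for n x
  proof (cases n)
    case 0
    show ?thesis
      unfolding F_def 0
      by (auto intro!: derivative_eq_intros sum.cong dest!: pos[OF _ x] simp: power2_eq_square)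
  next
    case (Suc i)
    have "((\<lambda>x. p k * ((-1) ^ i * fact n / (x + s k) ^ Suc n)) has_real_derivative
        p k * ((-1) ^ n * fact (Suc n) / (x + s k) ^ Suc (Suc n))) (at x)" if "k \<in> K" for k
    proof -
      have pow: "((\<lambda>x. (x + s k) ^ Suc n) has_real_derivative real (Suc n) * (x + s k) ^ n) (at x)"
        by (rule derivative_eq_intros refl | simp)+
      have "((\<lambda>x. c / (x + s k) ^ Suc n) has_real_derivative
          - c * real (Suc n) / (x + s k) ^ Suc (Suc n)) (at x)" for c :: real
        by (rule DERIV_cong[OF DERIV_divide[OF DERIV_const pow]])
          (use pos[OF that x] in \<open>simp_all add: divide_simps\<close>)
      from DERIV_cmult[OF this, of "(-1) ^ i * fact n" "p k"] show ?thesis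
        by (simp add: Suc mult_ac)
    qed
    then show ?thesis
      unfolding F_def Suc by (auto intro!: DERIV_sum simp: Suc)
  qed
  have gF: "g x = F 0 x" if "x > 0" for x
    using g[OF that] by (simp add: F_def)
  have "bernstein_function g"
    unfolding bernstein_function_def
  proof (intro conjI allI impI)
    show "g x \<ge> 0" if "x > 0" for x
      unfolding g[OF that]
      by (intro sum_nonneg mult_nonneg_nonneg p) (use s that in \<open>auto intro!: divide_left_mono mult_pos_pos pos\<close>)
    show "smooth_on_pos g"
      using gF F by (rule smooth_on_pos_chain)
    show "completely_monotone (deriv g)"
    proof (rule completely_monotone_chain[where F = "\<lambda>n. F (Suc n)"])
      show "deriv g x = F (Suc 0) x" if "x > 0" for x
        using deriv_funpow_chain[of g F, OF gF F that, of 1] by simp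
      show "(-1) ^ n * F (Suc n) x \<ge> 0" if x: "x > 0" for n x
      proof -
        have "(-1) ^ n * F (Suc n) x = (\<Sum>k\<in>K. p k * (fact (Suc n) / (x + s k) ^ Suc (Suc n)))"
          by (auto simp: F_def sum_distrib_left minus_one_power_iff intro!: sum.cong)
        also have "\<dots> \<ge> 0"
          by (intro sum_nonneg mult_nonneg_nonneg divide_nonneg_nonneg zero_le_power p
              less_imp_le[OF pos] x) auto
        finally show ?thesis .
      qed
    qed (rule F)
  qed
  moreover have cm: "completely_monotone m"
  proof (rule completely_monotone_chain[where F = "\<lambda>n t. \<Sum>k\<in>K. p k * ((- s k) ^ n * exp (- s k * t))"])
    show "(-1) ^ n * (\<Sum>k\<in>K. p k * ((- s k) ^ n * exp (- s k * t))) \<ge> 0" for n and t :: real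
    proof -
      have "(-1) ^ n * (\<Sum>k\<in>K. p k * ((- s k) ^ n * exp (- s k * t)))
          = (\<Sum>k\<in>K. p k * (s k ^ n * exp (- s k * t)))"
        by (auto simp: sum_distrib_left minus_one_power_iff power_minus[of "s _"] intro!: sum.cong)
      also have "\<dots> \<ge> 0"
        by (intro sum_nonneg mult_nonneg_nonneg zero_le_power p less_imp_le[OF s]) auto
      finally show ?thesis .
    qed
  qed (auto simp: m_def intro!: derivative_eq_intros sum.cong)
  moreover have "levy_triple g 0 0 \<nu>"
  proof -
    have m0: "m t \<ge> 0" for t
      by (auto simp: m_def intro!: sum_nonneg p mult_nonneg_nonneg)
    have meas: "m \<in> borel_measurable ?L"
      unfolding m_def by (auto intro!: measurable_restrict_space1)
    have m_int: "has_bochner_integral ?L m (\<Sum>k\<in>K. p k * (1 / s k))"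
      unfolding m_def
      by (intro has_bochner_integral_sum has_bochner_integral_mult_right has_bochner_integral_exp_pos s)
    have "(\<integral>\<^sup>+ t. ennreal (min 1 t) \<partial>\<nu>) = (\<integral>\<^sup>+ t. ennreal (m t) * ennreal (min 1 t) \<partial>?L)"
      unfolding \<nu>_def using meas by (intro nn_integral_density) (auto intro!: measurable_restrict_space1)
    also have "\<dots> \<le> (\<integral>\<^sup>+ t. ennreal (m t) \<partial>?L)"
      by (intro nn_integral_mono) (auto simp: m0 mult_left_le simp flip: ennreal_mult' intro!: ennreal_leI)
    also have "\<dots> < \<infinity>"
      using m_int m0 by (auto simp: has_bochner_integral_iff nn_integral_eq_integral)
    finally have fin: "(\<integral>\<^sup>+ t. ennreal (min 1 t) \<partial>\<nu>) < \<infinity>" .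
    have rep: "(\<integral>t. (1 - exp (- x * t)) \<partial>\<nu>) = g x" if x: "x > 0" for x
    proof -
      have "has_bochner_integral ?L
          (\<lambda>t. \<Sum>k\<in>K. p k * (exp (- s k * t) - exp (- (x + s k) * t)))
          (\<Sum>k\<in>K. p k * (1 / s k - 1 / (x + s k)))"
        by (intro has_bochner_integral_sum has_bochner_integral_mult_right
            has_bochner_integral_diff has_bochner_integral_exp_pos s pos x)
      moreover have "(\<Sum>k\<in>K. p k * (exp (- s k * t) - exp (- (x + s k) * t)))
          = m t * (1 - exp (- x * t))" for t
        unfolding m_def sum_distrib_right
        by (intro sum.cong) (auto simp: algebra_simps simp flip: exp_add)
      ultimately have "has_bochner_integral ?L (\<lambda>t. m t * (1 - exp (- x * t))) (g x)"
        using g[OF x] by simp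
      moreover have "(\<integral>t. (1 - exp (- x * t)) \<partial>\<nu>) = (\<integral>t. m t * (1 - exp (- x * t)) \<partial>?L)"
        unfolding \<nu>_def using meas m0
        by (subst integral_real_density) (auto intro!: measurable_restrict_space1)
      ultimately show ?thesis by (simp add: has_bochner_integral_iff)
    qed
    have "sets \<nu> = sets (restrict_space borel {0<..})"
      by (simp add: \<nu>_def sets_restrict_space)
    then show ?thesis
      using fin rep by (simp add: levy_triple_def)
  qed
  ultimately show ?thesis
    unfolding complete_bernstein_function_def \<nu>_def by blast
qed

section \<open>Rational functions with alternating zeros and poles\<close>

text \<open>
  Induction on the number of factors. Multiplying by the new factor
  \<open>(y + z) / (y + s) = 1 - (s - z) / (y + s)\<close>, with \<open>z = z\<^sub>n\<close> and \<open>s = s\<^sub>n\<close>, scales each old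
  coefficient \<open>p\<^sub>k\<close> by \<open>(s\<^sub>k - z) / (s\<^sub>k - s)\<close>, which is nonnegative because \<open>s\<^sub>k \<le> z < s\<close>. The new
  coefficient is \<open>s - z\<close> times the old product evaluated at \<open>y = - s\<close>, beyond all its zeros and poles,
  where every factor is positive. For this evaluation the expansion has to be carried through the
  induction at every \<open>y\<close> other than a pole, not only at positive \<open>y\<close>.
\<close>

lemma interlacing_partial_fractions:
  fixes z s :: "nat \<Rightarrow> real"
  assumes zs: "\<And>j. z j < s j" and sz: "\<And>j k. j < k \<Longrightarrow> s j \<le> z k"
  shows "\<exists>p. (\<forall>k. p k \<ge> 0) \<and> (\<forall>y. (\<forall>k<n. y + s k \<noteq> 0) \<longrightarrow>
    (\<Prod>j<n. (y + z j) / (y + s j)) = 1 - (\<Sum>k<n. p k / (y + s k)))"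
proof (induction n)
  case 0
  show ?case by (auto intro: exI[of _ "\<lambda>_. 0"])
next
  case (Suc n)
  then obtain p where p: "\<And>k. p k \<ge> 0"
    and eq: "\<And>y. (\<And>k. k < n \<Longrightarrow> y + s k \<noteq> 0) \<Longrightarrow>
      (\<Prod>j<n. (y + z j) / (y + s j)) = 1 - (\<Sum>k<n. p k / (y + s k))"
    by blast
  have less: "s k < s n" if "k < n" for k
    using sz[OF that] zs[of n] by linarith
  define c where "c = (\<Prod>j<n. (- s n + z j) / (- s n + s j))"
  have c: "c = 1 - (\<Sum>k<n. p k / (- s n + s k))"
    unfolding c_def by (rule eq) (use less in force)
  have c0: "c \<ge> 0"
    unfolding c_def
  proof (intro prod_nonneg divide_nonpos_nonpos)
    fix j assume "j \<in> {..<n}"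
    then show "- s n + s j \<le> 0" "- s n + z j \<le> 0"
      using less[of j] zs[of j] by auto
  qed
  define q where "q k = (if k < n then p k * ((s k - z n) / (s k - s n))
    else if k = n then (s n - z n) * c else 0)" for k
  have "q k \<ge> 0" for k
    using sz[of k n] less[of k] zs[of n] c0 p[of k]
    by (auto simp: q_def simp del: times_divide_eq_right
        intro!: mult_nonneg_nonneg divide_nonpos_nonpos)
  moreover have "(\<Prod>j<Suc n. (y + z j) / (y + s j)) = 1 - (\<Sum>k<Suc n. q k / (y + s k))"
    if y: "\<forall>k<Suc n. y + s k \<noteq> 0" for y
  proof -
    have yn: "y + s n \<noteq> 0" using y by simp
    have summand: "p k / (y + s k) * ((y + z n) / (y + s n))
        = q k / (y + s k) - (s n - z n) / (y + s n) * (p k / (- s n + s k))" if "k < n" for k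
    proof -
      have "y + s k \<noteq> 0" "s k - s n \<noteq> 0" using y less[OF that] that by auto
      then show ?thesis using yn that
        by (simp add: q_def divide_simps) (simp add: algebra_simps)
    qed
    have "(\<Prod>j<Suc n. (y + z j) / (y + s j))
        = (1 - (\<Sum>k<n. p k / (y + s k))) * ((y + z n) / (y + s n))"
      using eq[of y] y by simp
    also have "\<dots> = (y + z n) / (y + s n) - (\<Sum>k<n. p k / (y + s k) * ((y + z n) / (y + s n)))"
      by (simp only: left_diff_distrib sum_distrib_right mult_1)
    also have "(\<Sum>k<n. p k / (y + s k) * ((y + z n) / (y + s n)))
        = (\<Sum>k<n. q k / (y + s k)) - (s n - z n) / (y + s n) * (1 - c)"
      by (simp add: summand sum_subtractf c sum_distrib_left del: times_divide_eq_right times_divide_eq_left times_divide_times_eq)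
    also have "(y + z n) / (y + s n) = 1 - (s n - z n) / (y + s n)"
      using yn by (simp add: field_simps)
    also have "1 - (s n - z n) / (y + s n)
        - ((\<Sum>k<n. q k / (y + s k)) - (s n - z n) / (y + s n) * (1 - c))
        = 1 - ((\<Sum>k<n. q k / (y + s k)) + (s n - z n) * c / (y + s n))"
      by (simp add: right_diff_distrib)
    also have "\<dots> = 1 - (\<Sum>k<Suc n. q k / (y + s k))"
      by (simp add: q_def)
    finally show ?thesis .
  qed
  ultimately show ?case by blast
qed

section \<open>The Gamma quotient\<close>

theorem proposition4p4:
  fixes a :: nat and b :: real
  assumes "a \<ge> 1" and "0 < b" and "b \<le> 1"
  shows "complete_bernstein_function
           (\<lambda>y. Gamma (y + real a) * Gamma (y + b) / (Gamma y * Gamma (y + real a + b)))"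
proof -
  have "\<exists>p. (\<forall>k. p k \<ge> 0) \<and> (\<forall>y. (\<forall>k<a. y + (b + real k) \<noteq> 0) \<longrightarrow>
      (\<Prod>j<a. (y + real j) / (y + (b + real j))) = 1 - (\<Sum>k<a. p k / (y + (b + real k))))"
    by (rule interlacing_partial_fractions) (use assms in auto)
  then obtain p where p: "\<And>k. p k \<ge> 0"
    and eq: "\<And>y. (\<And>k. k < a \<Longrightarrow> y + (b + real k) \<noteq> 0) \<Longrightarrow>
      (\<Prod>j<a. (y + real j) / (y + (b + real j))) = 1 - (\<Sum>k<a. p k / (y + (b + real k)))"
    by blast
  \<comment> \<open>The expansion at \<open>y = 0\<close>, where the product vanishes, replaces the constant 1 by a sum over
    the poles.\<close>
  have "(\<Prod>j<a. (0 + real j) / (0 + (b + real j))) = 1 - (\<Sum>k<a. p k / (0 + (b + real k)))"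
    by (rule eq) (use assms in auto)
  moreover have "(\<Prod>j<a. (0 + real j) / (0 + (b + real j))) = 0"
    using assms by (intro prod_zero) (auto intro!: bexI[of _ 0])
  ultimately have one: "1 = (\<Sum>k<a. p k / (b + real k))" by simp
  show ?thesis
  proof (rule complete_bernstein_function_finite_Stieltjes[where K = "{..<a}" and p = p
        and s = "\<lambda>k. b + real k"])
    fix y :: real assume y: "y > 0"
    have "Gamma (y + real a) * Gamma (y + b) / (Gamma y * Gamma (y + real a + b))
        = pochhammer y a / pochhammer (y + b) a"
      using y assms pochhammer_Gamma[of y a] pochhammer_Gamma[of "y + b" a]
      by (simp add: nonpos_Ints_def add_ac)
    also have "\<dots> = (\<Prod>j<a. (y + real j) / (y + (b + real j)))"
      by (simp add: pochhammer_prod atLeast0LessThan prod_dividef add.assoc)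
    also have "\<dots> = 1 - (\<Sum>k<a. p k / (y + (b + real k)))"
      by (rule eq) (use y assms in auto)
    also have "\<dots> = (\<Sum>k<a. p k * (1 / (b + real k) - 1 / (y + (b + real k))))"
      by (subst one) (simp add: sum_subtractf right_diff_distrib)
    finally show "Gamma (y + real a) * Gamma (y + b) / (Gamma y * Gamma (y + real a + b))
        = (\<Sum>k<a. p k * (1 / (b + real k) - 1 / (y + (b + real k))))" .
  qed (use p assms in auto)
qed

end
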